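(* Every binary sextic can be written as a sum of at most three cubes of binary quadratic forms. That is, for every homogeneous polynomial $p\in\mathbb{C}[x,y]$ of degree $6$ there are homogeneous polynomials $q_1,\dots,q_r\in\mathbb{C}[x,y]$ of degree $2$, with $r\le 3$, such that $p=q_1^3+\dots+q_r^3$.
   Context: A binary sextic (resp. binary quadratic form) is a homogeneous polynomial of degree $6$ (resp. $2$) in $\mathbb{C}[x,y]$. *)

theory Defs
  imports Complex_Main "HOL-Computational_Algebra.Polynomial"
begin

text \<open>
  The ring \<open>\<complex>[x,y]\<close> is modelled as \<open>\<complex>[x][y]\<close>, the type \<^typ>\<open>complex poly poly\<close>: the monomial
  \<open>x\<^sup>j y\<^sup>i\<close> is \<^term>\<open>monom (monom 1 j) i\<close>, and \<^term>\<open>coeff (coeff p i) j\<close> is its coefficient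
  in \<open>p\<close>.  As usual, the zero polynomial counts as homogeneous of every degree.
\<close>

definition homogeneous :: "nat \<Rightarrow> 'a::zero poly poly \<Rightarrow> bool" where
  "homogeneous d p \<longleftrightarrow> (\<forall>i j. coeff (coeff p i) j \<noteq> 0 \<longrightarrow> i + j = d)"

end

theory Submission
  imports Defs "HOL-Computational_Algebra.Fundamental_Theorem_Algebra"
begin

text \<open>
  Setting one variable equal to \<open>1\<close> turns binary forms of degree \<open>d\<close> into univariate polynomials of
  degree at most \<open>d\<close>, compatibly with sums and products, so the task is to write every univariate
  complex polynomial \<open>f\<close> of degree at most \<open>6\<close> as a sum of three cubes of polynomials of degree at
  most \<open>2\<close>.

  If \<open>f(0) \<noteq> 0\<close>, the Taylor polynomial \<open>q\<close> of degree \<open>2\<close> of a cube root of \<open>f\<close> at \<open>0\<close> satisfies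
  \<open>f = q\<^sup>3 + s\<^sup>3 c(s)\<close> with \<open>c\<close> of degree at most \<open>3\<close>. A generic cubic \<open>c\<close> is a sum of two cubes of
  linear polynomials \<open>a, b\<close>, and then \<open>f = q\<^sup>3 + (s a)\<^sup>3 + (s b)\<^sup>3\<close>. This works as soon as a certain
  polynomial in the coefficients of \<open>f\<close>, called \<open>genericity\<close> below, does not vanish
  (\<open>generic_sum_of_3_cubes\<close>).

  An arbitrary \<open>f\<close> is made generic by moving and rescaling the variable. Suppose that \<open>f\<close> has a
  root of multiplicity \<open>m\<close>, placed at \<open>0\<close>, so that \<open>f(t) = t\<^sup>m h(t)\<close> with \<open>h(0) \<noteq> 0\<close>. Substituting
  \<open>t = \<epsilon> (1 + s)\<close> and dividing by \<open>\<epsilon>\<^sup>m\<close> gives \<open>(1 + s)\<^sup>m h(\<epsilon> (1 + s))\<close>, whose coefficients tend to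
  those of \<open>h(0) (1 + s)\<^sup>m\<close> for \<open>\<epsilon> \<rightarrow> 0\<close>. For \<open>m = 1, 2, 4, 5\<close> this limit is generic, as a
  computation with four explicit polynomials shows (\<open>genericity_binomial\<close>), hence so is the
  rescaled \<open>f\<close> for some small \<open>\<epsilon> \<noteq> 0\<close> (\<open>root_at_0_sum_of_3_cubes\<close>). For \<open>m = 3, 6\<close> the limit is
  itself the cube of a polynomial and the argument breaks down; but if every root of \<open>f\<close> has
  multiplicity \<open>3\<close> or \<open>6\<close>, then \<open>f\<close> is a single cube.
\<close>

section \<open>Binary forms and univariate polynomials\<close>

definition homogenize :: "nat \<Rightarrow> 'a::comm_semiring_1 poly \<Rightarrow> 'a poly poly" where
  "homogenize d f = (\<Sum>i\<le>d. monom (monom (coeff f i) (d - i)) i)"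

lemma coeff_homogenize:
  assumes "degree f \<le> d"
  shows "coeff (homogenize d f) i = monom (coeff f i) (d - i)"
proof (cases "i \<le> d")
  case True
  then show ?thesis
    by (simp add: homogenize_def coeff_sum if_distrib sum.delta)
next
  case False
  then show ?thesis
    using assms by (simp add: homogenize_def coeff_sum if_distrib sum.delta coeff_eq_0)
qed

lemma homogeneous_homogenize:
  assumes "degree f \<le> d"
  shows "homogeneous d (homogenize d f)"
  using assms le_degree[of f] by (fastforce simp: homogeneous_def coeff_homogenize split: if_splits)

lemma homogenize_add:
  "homogenize d (f + g) = homogenize d f + homogenize d g"
  by (simp add: homogenize_def add_monom [symmetric] sum.distrib)

text \<open>
  With the degree bounds, the truncation in \<open>homogenize\<close> loses nothing and coefficients of products
  are the same convolution on both sides; without them, terms of degree above \<open>m\<close> or \<open>n\<close> would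
  survive only on the left.
\<close>

lemma homogenize_mult:
  assumes f: "degree f \<le> m" and g: "degree g \<le> n"
  shows "homogenize (m + n) (f * g) = homogenize m f * homogenize n g"
proof (rule poly_eqI)
  fix k
  have fg: "degree (f * g) \<le> m + n"
    using degree_mult_le[of f g] f g by linarith
  have monoms: "monom (coeff f i) (m - i) * monom (coeff g (k - i)) (n - (k - i))
      = monom (coeff f i * coeff g (k - i)) (m + n - k)" if "i \<le> k" for i
  proof (cases "i \<le> m \<and> k - i \<le> n")
    case True
    then have "(m - i) + (n - (k - i)) = m + n - k" using that by arith
    then show ?thesis using that by (simp add: mult_monom)
  next
    case False
    then have "coeff f i = 0 \<or> coeff g (k - i) = 0"
      using f g by (metis coeff_eq_0 le_trans not_le)
    then show ?thesis by auto
  qed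
  have "coeff (homogenize m f * homogenize n g) k
      = (\<Sum>i\<le>k. monom (coeff f i * coeff g (k - i)) (m + n - k))"
    by (simp add: coeff_mult coeff_homogenize f g monoms del: diff_diff_right)
  also have "\<dots> = monom (coeff (f * g) k) (m + n - k)"
    by (rule poly_eqI) (simp add: coeff_sum coeff_mult)
  finally show "coeff (homogenize (m + n) (f * g)) k = coeff (homogenize m f * homogenize n g) k"
    by (simp add: coeff_homogenize fg)
qed

lemma homogenize_cube:
  assumes "degree q \<le> d"
  shows "homogenize (3 * d) (q ^ 3) = homogenize d q ^ 3"
proof -
  have "degree (q * q) \<le> d + d"
    using degree_mult_le[of q q] assms by linarith
  then have "homogenize (d + (d + d)) (q * (q * q)) = homogenize d q * (homogenize d q * homogenize d q)"
    using assms by (simp add: homogenize_mult)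
  moreover have "d + (d + d) = 3 * d" by simp
  ultimately show ?thesis by (simp add: power3_eq_cube mult.assoc)
qed

lemma homogeneous_imp_homogenize:
  assumes "homogeneous d p"
  obtains f where "degree f \<le> d" and "p = homogenize d f"
proof
  define f where "f = (\<Sum>i\<le>d. monom (coeff (coeff p i) (d - i)) i)"
  show deg: "degree f \<le> d"
    unfolding f_def by (rule degree_sum_le) (auto intro: order_trans[OF degree_monom_le])
  have f: "coeff f i = (if i \<le> d then coeff (coeff p i) (d - i) else 0)" for i
    by (auto simp: f_def coeff_sum if_distrib sum.delta)
  show "p = homogenize d f"
  proof (intro poly_eqI)
    fix i j
    have "coeff (coeff p i) j = 0" if "i + j \<noteq> d"
      using assms that unfolding homogeneous_def by blast
    then show "coeff (coeff p i) j = coeff (coeff (homogenize d f) i) j"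
      by (auto simp: coeff_homogenize deg f)
  qed
qed

section \<open>Sums of three cubes of quadratic polynomials\<close>

text \<open>
  Zero is allowed as a summand, so that this covers sums of fewer cubes as well.
\<close>

definition sum_of_3_cubes :: "complex poly \<Rightarrow> bool" where
  "sum_of_3_cubes f \<longleftrightarrow>
     (\<exists>a b c. degree a \<le> 2 \<and> degree b \<le> 2 \<and> degree c \<le> 2 \<and> f = a ^ 3 + b ^ 3 + c ^ 3)"

lemma complex_cube_root:
  obtains w :: complex where "w ^ 3 = z"
proof -
  have "\<exists>w. poly ([:- z, 0, 0, 1:]) w = 0"
    by (rule fundamental_theorem_of_algebra_alt) auto
  then show ?thesis
    using that by (auto simp: power3_eq_cube algebra_simps)
qed

lemma cube_sum_of_3_cubes:
  assumes "degree a \<le> 2"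
  shows "sum_of_3_cubes (a ^ 3)"
  unfolding sum_of_3_cubes_def
  by (rule exI[of _ a], rule exI[of _ 0], rule exI[of _ 0]) (use assms in simp)

lemma sum_of_3_cubes_smult:
  assumes "sum_of_3_cubes f"
  shows "sum_of_3_cubes (smult z f)"
proof -
  obtain w where w: "w ^ 3 = z" by (rule complex_cube_root)
  obtain a b c where *: "degree a \<le> 2" "degree b \<le> 2" "degree c \<le> 2" "f = a ^ 3 + b ^ 3 + c ^ 3"
    using assms by (auto simp: sum_of_3_cubes_def)
  have "smult z (g ^ 3) = smult w g ^ 3" for g
    by (simp add: smult_power w)
  then have "smult z f = smult w a ^ 3 + smult w b ^ 3 + smult w c ^ 3"
    by (simp add: *(4) smult_add_right)
  moreover have "degree (smult w g) \<le> 2" if "degree g \<le> 2" for g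
    using that degree_smult_le order_trans by blast
  ultimately show ?thesis
    using * unfolding sum_of_3_cubes_def by blast
qed

lemma smult_cube_sum_of_3_cubes:
  assumes "degree a \<le> 2"
  shows "sum_of_3_cubes (smult z (a ^ 3))"
  using assms by (intro sum_of_3_cubes_smult cube_sum_of_3_cubes)

lemma pcompose_power: "pcompose (f ^ n) l = pcompose f l ^ n"
  for f l :: "'a::comm_ring_1 poly"
  by (induction n) (simp_all add: pcompose_mult pcompose_1)

lemma sum_of_3_cubes_pcompose:
  assumes "sum_of_3_cubes f" and "degree l \<le> 1"
  shows "sum_of_3_cubes (pcompose f l)"
proof -
  obtain a b c where *: "degree a \<le> 2" "degree b \<le> 2" "degree c \<le> 2" "f = a ^ 3 + b ^ 3 + c ^ 3"
    using assms by (auto simp: sum_of_3_cubes_def)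
  have "pcompose f l = pcompose a l ^ 3 + pcompose b l ^ 3 + pcompose c l ^ 3"
    by (simp add: *(4) pcompose_add pcompose_power)
  moreover have "degree (pcompose g l) \<le> 2" if "degree g \<le> 2" for g
    using mult_le_mono[OF that assms(2)] by (simp add: degree_pcompose)
  ultimately show ?thesis
    using * unfolding sum_of_3_cubes_def by blast
qed

section \<open>Generic cubics are sums of two cubes\<close>

text \<open>
  For the cubic \<open>c0 + c1 u + c2 u\<^sup>2 + c3 u\<^sup>3\<close> this is the discriminant of its suitably normalized
  Hessian covariant, which is \<open>-3\<close> times the discriminant of the cubic.
\<close>

definition hessian_disc :: "'a::comm_ring_1 \<Rightarrow> 'a \<Rightarrow> 'a \<Rightarrow> 'a \<Rightarrow> 'a" where
  "hessian_disc c0 c1 c2 c3 =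
     (c1 * c2 - 9 * c0 * c3)^2 - 4 * (3 * c0 * c2 - c1^2) * (3 * c1 * c3 - c2^2)"

text \<open>
  Sylvester's method. A representation \<open>A (1 + r u)\<^sup>3 + B (1 + s u)\<^sup>3\<close> amounts to
  \<open>A r\<^sup>k + B s\<^sup>k = a\<^sub>k\<close> for \<open>k \<le> 3\<close>, where \<open>a\<^sub>k\<close> is the coefficient of \<open>u\<^sup>k\<close> divided by
  \<open>3 choose k\<close>. So \<open>a\<close> has to satisfy the linear recurrence of order two with characteristic roots
  \<open>r\<close> and \<open>s\<close>. The two equations for the coefficients \<open>h2, h1, h0\<close> of such a recurrence are solved
  by a cross product. The hypotheses say that \<open>h2\<close> is nonzero and that the roots are distinct, after
  which \<open>A\<close> and \<open>B\<close> are determined by \<open>a\<^sub>0\<close> and \<open>a\<^sub>1\<close>.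
\<close>

lemma cubic_sum_of_2_cubes:
  fixes c0 c1 c2 c3 :: complex
  assumes lead: "3 * c0 * c2 - c1^2 \<noteq> 0" and disc: "hessian_disc c0 c1 c2 c3 \<noteq> 0"
  obtains a b where "degree a \<le> 1" "degree b \<le> 1" "[:c0, c1, c2, c3:] = a ^ 3 + b ^ 3"
proof -
  define h2 h1 h0 where h: "h2 = 3 * c0 * c2 - c1^2" "h1 = c1 * c2 - 9 * c0 * c3"
    "h0 = 3 * c1 * c3 - c2^2"
  define d where "d = csqrt (h1 ^ 2 - 4 * h2 * h0)"
  have d2: "d ^ 2 = h1 ^ 2 - 4 * h2 * h0"
    by (simp add: d_def)
  have h2: "h2 \<noteq> 0" and d: "d \<noteq> 0"
    using lead disc d2 by (auto simp: h hessian_disc_def)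
  define r s where rs: "r = (- h1 + d) / (2 * h2)" "s = (- h1 - d) / (2 * h2)"
  have "r - s = d / h2"
    using h2 by (simp add: rs field_simps)
  then have "r \<noteq> s" using d h2 by auto
  have root: "h2 * z ^ 2 + h1 * z + h0 = 0" if "2 * h2 * z = - h1 + e" "e ^ 2 = d ^ 2" for z e
  proof -
    have "4 * h2 * (h2 * z ^ 2 + h1 * z + h0) = (2 * h2 * z + h1) ^ 2 - d ^ 2"
      unfolding d2 by (simp add: algebra_simps power2_eq_square)
    also have "\<dots> = 0" using that by simp
    finally show ?thesis using h2 by simp
  qed
  have r: "h2 * r ^ 2 + h1 * r + h0 = 0"
    by (rule root[of _ d]) (use h2 in \<open>auto simp: rs\<close>)
  have s: "h2 * s ^ 2 + h1 * s + h0 = 0"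
    by (rule root[of _ "- d"]) (use h2 in \<open>auto simp: rs\<close>)
  have r': "h2 * r ^ 2 = - h1 * r - h0" and s': "h2 * s ^ 2 = - h1 * s - h0"
    using r s by algebra+
  \<comment> \<open>Cramer's rule for \<open>A + B = c0\<close> and \<open>A r + B s = c1 / 3\<close>.\<close>
  define A B where AB: "A = (c1 / 3 - s * c0) / (r - s)" "B = c0 - A"
  have A: "A * (r - s) = c1 / 3 - s * c0"
    using \<open>r \<noteq> s\<close> by (simp add: AB)
  have k0: "A + B = c0" by (simp add: AB)
  have k1: "3 * (A * r + B * s) = c1"
    using A by (simp add: AB(2) algebra_simps)
  \<comment> \<open>The recurrence carries the equations for \<open>c0\<close> and \<open>c1\<close> over to \<open>c2\<close> and then to \<open>c3\<close>.\<close>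
  have "h2 * (3 * (A * r ^ 2 + B * s ^ 2)) = 3 * A * (h2 * r ^ 2) + 3 * B * (h2 * s ^ 2)"
    by (simp add: algebra_simps)
  also have "\<dots> = 3 * A * (- h1 * r - h0) + 3 * B * (- h1 * s - h0)"
    by (simp only: r' s')
  also have "\<dots> = - h1 * c1 - 3 * h0 * c0"
    unfolding k0[symmetric] k1[symmetric] by (simp add: algebra_simps)
  also have "\<dots> = h2 * c2"
    by (simp add: h algebra_simps power2_eq_square)
  finally have k2: "3 * (A * r ^ 2 + B * s ^ 2) = c2"
    using h2 by simp
  have "h2 * (3 * (A * r ^ 3 + B * s ^ 3)) = 3 * A * r * (h2 * r ^ 2) + 3 * B * s * (h2 * s ^ 2)"
    by (simp add: algebra_simps power3_eq_cube power2_eq_square)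
  also have "\<dots> = 3 * A * r * (- h1 * r - h0) + 3 * B * s * (- h1 * s - h0)"
    by (simp only: r' s')
  also have "\<dots> = - h1 * c2 - h0 * c1"
    unfolding k1[symmetric] k2[symmetric] by (simp add: algebra_simps power2_eq_square)
  also have "\<dots> = h2 * (3 * c3)"
    by (simp add: h algebra_simps power2_eq_square)
  finally have "3 * (A * r ^ 3 + B * s ^ 3) = 3 * c3"
    using h2 by (metis mult_cancel_left)
  then have k3: "A * r ^ 3 + B * s ^ 3 = c3"
    by (metis mult_cancel_left zero_neq_numeral)
  obtain u v where uv: "u ^ 3 = A" "v ^ 3 = B"
    by (metis complex_cube_root)
  have cube: "smult w [:1, t:] ^ 3 = [:C, 3 * (C * t), 3 * (C * t ^ 2), C * t ^ 3:]"
    if "w ^ 3 = C" for w t C :: complex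
    unfolding that [symmetric] by (simp add: power3_eq_cube power2_eq_square)
  show ?thesis
  proof
    show "degree (smult u [:1, r:]) \<le> 1" "degree (smult v [:1, s:]) \<le> 1"
      by (auto intro: order_trans[OF degree_smult_le])
    show "[:c0, c1, c2, c3:] = smult u [:1, r:] ^ 3 + smult v [:1, s:] ^ 3"
      unfolding cube[OF uv(1)] cube[OF uv(2)]
      by (simp add: k0 [symmetric] k1 [symmetric] k2 [symmetric] k3 [symmetric] distrib_left)
  qed
qed

section \<open>Splitting off the cube root to second order\<close>

text \<open>
  With \<open>A\<close> the coefficient sequence of \<open>f\<close>, the Taylor polynomial of degree \<open>2\<close> of a cube root of
  \<open>f\<close> is \<open>A\<^sub>0\<^bsup>1/3\<^esup> (1 + A\<^sub>1 s / (3 A\<^sub>0) + (A\<^sub>2 / (3 A\<^sub>0) - A\<^sub>1\<^sup>2 / (9 A\<^sub>0\<^sup>2)) s\<^sup>2)\<close>. The definition is the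
  multiple of it by \<open>9 A\<^sub>0\<^bsup>5/3\<^esup>\<close>, which is polynomial in \<open>A\<close>; its cube approximates
  \<open>729 A\<^sub>0\<^sup>5 f\<close>.
\<close>

definition cube_root_jet :: "(nat \<Rightarrow> 'a::comm_ring_1) \<Rightarrow> 'a poly" where
  "cube_root_jet A = [:9 * A 0 ^ 2, 3 * A 0 * A 1, 3 * A 0 * A 2 - A 1 ^ 2:]"

text \<open>
  The coefficients \<open>c\<^sub>k\<close> in \<open>729 A\<^sub>0\<^sup>5 f = q\<^sup>3 + s\<^sup>3 (c\<^sub>0 + c\<^sub>1 s + c\<^sub>2 s\<^sup>2 + c\<^sub>3 s\<^sup>3)\<close>, where \<open>q\<close> is the
  rescaled Taylor polynomial of the cube root.
\<close>

definition remainder_coeff :: "(nat \<Rightarrow> 'a::comm_ring_1) \<Rightarrow> nat \<Rightarrow> 'a" where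
  "remainder_coeff A k = 729 * A 0 ^ 5 * A (k + 3) - coeff (cube_root_jet A ^ 3) (k + 3)"

text \<open>
  The product of all quantities that have to be nonzero: \<open>A\<^sub>0\<close>, for the cube root to have a Taylor
  polynomial, and the two expressions in the hypotheses of \<open>cubic_sum_of_2_cubes\<close> for the
  remaining cubic. Being a polynomial in \<open>A\<close>, it depends continuously on \<open>A\<close>.
\<close>

definition genericity :: "(nat \<Rightarrow> 'a::comm_ring_1) \<Rightarrow> 'a" where
  "genericity A = (let c = remainder_coeff A in
     A 0 * (3 * c 0 * c 2 - c 1 ^ 2) * hessian_disc (c 0) (c 1) (c 2) (c 3))"

lemma quadratic_cube:
  "[:p, q, r:] ^ 3 = [:p ^ 3, 3 * p ^ 2 * q, 3 * p * (p * r + q ^ 2), q ^ 3 + 6 * p * q * r,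
     3 * p * r ^ 2 + 3 * q ^ 2 * r, 3 * q * r ^ 2, r ^ 3:]"
  for p q r :: "'a::comm_ring_1"
  by (simp add: power3_eq_cube power2_eq_square algebra_simps)

lemma cube_root_jet_cube:
  "cube_root_jet A ^ 3 =
    [:729 * A 0 ^ 6, 729 * A 0 ^ 5 * A 1, 729 * A 0 ^ 5 * A 2,
      (3 * A 0 * A 1) ^ 3 + 6 * (9 * A 0 ^ 2) * (3 * A 0 * A 1) * (3 * A 0 * A 2 - A 1 ^ 2),
      3 * (9 * A 0 ^ 2) * (3 * A 0 * A 2 - A 1 ^ 2) ^ 2
        + 3 * (3 * A 0 * A 1) ^ 2 * (3 * A 0 * A 2 - A 1 ^ 2),
      3 * (3 * A 0 * A 1) * (3 * A 0 * A 2 - A 1 ^ 2) ^ 2,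
      (3 * A 0 * A 2 - A 1 ^ 2) ^ 3:]"
proof -
  have "(9 * A 0 ^ 2) ^ 3 = 729 * A 0 ^ 6"
    "3 * (9 * A 0 ^ 2) ^ 2 * (3 * A 0 * A 1) = 729 * A 0 ^ 5 * A 1"
    "3 * (9 * A 0 ^ 2) * (9 * A 0 ^ 2 * (3 * A 0 * A 2 - A 1 ^ 2) + (3 * A 0 * A 1) ^ 2)
       = 729 * A 0 ^ 5 * A 2"
    by (simp_all add: power_mult_distrib) (simp_all add: algebra_simps eval_nat_numeral)
  then show ?thesis
    unfolding cube_root_jet_def quadratic_cube by (simp only:)
qed

lemma coeff_sextic:
  "coeff [:a, b, c, d, e, f, g:] 0 = a" "coeff [:a, b, c, d, e, f, g:] 1 = b"
  "coeff [:a, b, c, d, e, f, g:] 2 = c" "coeff [:a, b, c, d, e, f, g:] 3 = d"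
  "coeff [:a, b, c, d, e, f, g:] 4 = e" "coeff [:a, b, c, d, e, f, g:] 5 = f"
  "coeff [:a, b, c, d, e, f, g:] 6 = g"
  by (simp_all add: numeral_eq_Suc)

lemma remainder_coeff_simps:
  "remainder_coeff A 0 = 729 * A 0 ^ 5 * A 3
     - ((3 * A 0 * A 1) ^ 3 + 6 * (9 * A 0 ^ 2) * (3 * A 0 * A 1) * (3 * A 0 * A 2 - A 1 ^ 2))"
  "remainder_coeff A 1 = 729 * A 0 ^ 5 * A 4
     - (3 * (9 * A 0 ^ 2) * (3 * A 0 * A 2 - A 1 ^ 2) ^ 2
        + 3 * (3 * A 0 * A 1) ^ 2 * (3 * A 0 * A 2 - A 1 ^ 2))"
  "remainder_coeff A 2 = 729 * A 0 ^ 5 * A 5 - 3 * (3 * A 0 * A 1) * (3 * A 0 * A 2 - A 1 ^ 2) ^ 2"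
  "remainder_coeff A 3 = 729 * A 0 ^ 5 * A 6 - (3 * A 0 * A 2 - A 1 ^ 2) ^ 3"
  by (simp_all only: remainder_coeff_def cube_root_jet_cube coeff_sextic
        add_0 one_plus_numeral numeral_plus_numeral add_num_simps)

text \<open>
  The exponent is the degree of the genericity polynomial: the remainder coefficients have degree
  \<open>6\<close>, so the three factors have degrees \<open>1\<close>, \<open>2 * 6\<close> and \<open>4 * 6\<close>. Scaling reduces the
  nonvanishing at \<open>h(0) (1 + s)\<^sup>m\<close> to a numerical check.
\<close>

lemma genericity_scale:
  fixes z :: "'a::comm_ring_1"
  shows "genericity (\<lambda>k. z * A k) = z ^ 37 * genericity A"
proof -
  have "cube_root_jet (\<lambda>k. z * A k) = smult (z ^ 2) (cube_root_jet A)"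
    by (simp add: cube_root_jet_def algebra_simps power2_eq_square)
  then have jet: "cube_root_jet (\<lambda>k. z * A k) ^ 3 = smult (z ^ 6) (cube_root_jet A ^ 3)"
    by (simp add: smult_power flip: power_mult)
  have "(z * A 0) ^ 5 * (z * A k) = z ^ 6 * (A 0 ^ 5 * A k)" for k
    by (simp add: power_mult_distrib power_numeral_reduce mult_ac)
  then have c: "remainder_coeff (\<lambda>k. z * A k) k = z ^ 6 * remainder_coeff A k" for k
    by (simp add: remainder_coeff_def jet right_diff_distrib mult.assoc mult.left_commute[of _ "z ^ 6"])
  have lead: "3 * (w * c0) * (w * c2) - (w * c1) ^ 2 = w ^ 2 * (3 * c0 * c2 - c1 ^ 2)"
    for w c0 c1 c2 :: 'a
    by (simp add: algebra_simps power2_eq_square)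
  have disc: "hessian_disc (w * c0) (w * c1) (w * c2) (w * c3) = w ^ 4 * hessian_disc c0 c1 c2 c3"
    for w c0 c1 c2 c3 :: 'a
  proof -
    have "w * c1 * (w * c2) - 9 * (w * c0) * (w * c3) = w ^ 2 * (c1 * c2 - 9 * c0 * c3)"
      "3 * (w * c1) * (w * c3) - (w * c2) ^ 2 = w ^ 2 * (3 * c1 * c3 - c2 ^ 2)"
      by (simp_all add: algebra_simps power2_eq_square)
    moreover have "(w ^ 2 * x) ^ 2 - 4 * (w ^ 2 * y) * (w ^ 2 * z) = w ^ 4 * (x ^ 2 - 4 * y * z)"
      for x y z :: 'a
      by (simp add: algebra_simps eval_nat_numeral)
    ultimately show ?thesis
      unfolding hessian_disc_def lead by simp
  qed
  have "z * ((z ^ 6) ^ 2 * (z ^ 6) ^ 4) = z ^ 37"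
    by (simp flip: power_mult power_add power_Suc)
  moreover have "z * a * ((z ^ 6) ^ 2 * x) * ((z ^ 6) ^ 4 * y)
      = z * ((z ^ 6) ^ 2 * (z ^ 6) ^ 4) * (a * x * y)" for a x y
    by (simp only: mult_ac)
  ultimately have shuffle: "z * a * ((z ^ 6) ^ 2 * x) * ((z ^ 6) ^ 4 * y) = z ^ 37 * (a * x * y)"
    for a x y
    by simp
  show ?thesis
    unfolding genericity_def Let_def c lead disc by (rule shuffle)
qed

lemma degree_jet_cube: "degree (cube_root_jet A ^ 3) \<le> 6"
proof -
  have "degree (cube_root_jet A) \<le> 2"
    by (simp add: cube_root_jet_def)
  then show ?thesis
    using degree_power_le[of "cube_root_jet A" 3] by linarith
qed

lemma cube_root_jet_remainder:
  assumes "degree f \<le> 6"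
  defines "c \<equiv> remainder_coeff (coeff f)"
  shows "smult (729 * coeff f 0 ^ 5) f
    = cube_root_jet (coeff f) ^ 3 + [:0, 1:] ^ 3 * [:c 0, c 1, c 2, c 3:]"
proof (rule poly_eqI)
  fix k :: nat
  have X: "[:0, 1:] ^ 3 = (monom 1 3 :: 'a poly)"
    by (simp add: monom_altdef)
  define C where "C = [:c 0, c 1, c 2, c 3:]"
  have "coeff (smult (729 * coeff f 0 ^ 5) f) k
    = coeff (cube_root_jet (coeff f) ^ 3 + [:0, 1:] ^ 3 * C) k"
  proof (cases "k < 3")
    case True
    then have "k = 0 \<or> k = 1 \<or> k = 2" by linarith
    moreover have "729 * x ^ 5 * x = 729 * x ^ 6" for x :: 'a
      by (simp add: power_numeral_reduce mult_ac)
    ultimately show ?thesis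
      using True by (auto simp: X coeff_monom_mult cube_root_jet_cube coeff_sextic[simplified])
  next
    case False
    then obtain j where j: "k = j + 3" by (metis add.commute le_add_diff_inverse not_less)
    have "coeff C j = c j"
    proof (cases "j \<le> 3")
      case True
      then have "j = 0 \<or> j = 1 \<or> j = 2 \<or> j = 3" by linarith
      then show ?thesis by (auto simp: C_def numeral_eq_Suc)
    next
      case False
      then have "coeff f (j + 3) = 0" "coeff (cube_root_jet (coeff f) ^ 3) (j + 3) = 0"
        using assms(1) degree_jet_cube[of "coeff f"] by (auto intro!: coeff_eq_0)
      moreover have "coeff C j = 0"
        using False by (intro coeff_eq_0) (auto simp: C_def)
      ultimately show ?thesis by (simp add: c_def remainder_coeff_def)
    qed
    then show ?thesis
      by (simp add: X coeff_monom_mult j) (simp add: c_def remainder_coeff_def)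
  qed
  then show "coeff (smult (729 * coeff f 0 ^ 5) f) k
    = coeff (cube_root_jet (coeff f) ^ 3 + [:0, 1:] ^ 3 * [:c 0, c 1, c 2, c 3:]) k"
    by (simp only: C_def)
qed

text \<open>
  The cubic that remains after the cube of the Taylor polynomial is a sum of two cubes of linear
  polynomials. The factor \<open>s\<^sup>3\<close> in front of it is absorbed into these, which makes them quadratic.
\<close>

lemma generic_sum_of_3_cubes:
  assumes deg: "degree f \<le> 6" and gen: "genericity (coeff f) \<noteq> 0"
  shows "sum_of_3_cubes f"
proof -
  define c where "c = remainder_coeff (coeff f)"
  define J where "J = cube_root_jet (coeff f)"
  have nz: "coeff f 0 \<noteq> 0" "3 * c 0 * c 2 - c 1 ^ 2 \<noteq> 0" "hessian_disc (c 0) (c 1) (c 2) (c 3) \<noteq> 0"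
    using gen by (auto simp: genericity_def c_def Let_def)
  obtain a b where ab: "degree a \<le> 1" "degree b \<le> 1" "[:c 0, c 1, c 2, c 3:] = a ^ 3 + b ^ 3"
    using cubic_sum_of_2_cubes[OF nz(2,3)] .
  have "smult (729 * coeff f 0 ^ 5) f = J ^ 3 + ([:0, 1:] * a) ^ 3 + ([:0, 1:] * b) ^ 3"
    unfolding J_def power_mult_distrib
    using cube_root_jet_remainder[OF deg, folded c_def]
    by (simp only: ab(3) distrib_left add.assoc)
  moreover have "degree J \<le> 2" "degree ([:0, 1:] * a) \<le> 2" "degree ([:0, 1:] * b) \<le> 2"
    using ab degree_mult_le[of "[:0, 1:]" a] degree_mult_le[of "[:0, 1:]" b]
    by (auto simp: J_def cube_root_jet_def)
  ultimately have "sum_of_3_cubes (smult (729 * coeff f 0 ^ 5) f)"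
    unfolding sum_of_3_cubes_def by blast
  from sum_of_3_cubes_smult[OF this, of "inverse (729 * coeff f 0 ^ 5)"] nz(1)
  show ?thesis by simp
qed

section \<open>Polynomials with a root of multiplicity 1, 2, 4 or 5\<close>

text \<open>
  For \<open>m = 3\<close> and \<open>m = 6\<close> the cube root \<open>(1 + s)\<^bsup>m/3\<^esup>\<close> of \<open>(1 + s)\<^sup>m\<close> equals its Taylor polynomial of
  degree \<open>2\<close>, so the remainder and with it the genericity vanish; these multiplicities have to be
  left out.
\<close>

lemma genericity_binomial:
  fixes z :: complex
  assumes "m \<in> {1, 2, 4, 5}" and "z \<noteq> 0"
  shows "genericity (\<lambda>k. z * of_nat (m choose k)) \<noteq> 0"
proof -
  have choose: "2 choose 2 = (1::nat)" "4 choose 2 = (6::nat)" "4 choose 3 = (4::nat)"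
    "5 choose 2 = (10::nat)" "5 choose 3 = (10::nat)" "5 choose 4 = (5::nat)"
    by (simp_all add: numeral_eq_Suc)
  have "genericity (\<lambda>k. complex_of_nat (m choose k)) \<noteq> 0"
    using assms(1) unfolding genericity_def Let_def hessian_disc_def remainder_coeff_simps
    by (elim insertE emptyE) (simp_all add: choose binomial_eq_0)
  then show ?thesis
    using assms(2) by (simp only: genericity_scale) simp
qed

lemma genericity_eventually_nonzero:
  fixes A :: "complex \<Rightarrow> nat \<Rightarrow> complex"
  assumes "\<And>k. isCont (\<lambda>\<epsilon>. A \<epsilon> k) 0" and "genericity (A 0) \<noteq> 0"
  obtains \<epsilon> where "\<epsilon> \<noteq> 0" "genericity (A \<epsilon>) \<noteq> 0"
proof -
  have c: "isCont (\<lambda>\<epsilon>. remainder_coeff (A \<epsilon>) 0) 0" "isCont (\<lambda>\<epsilon>. remainder_coeff (A \<epsilon>) 1) 0"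
    "isCont (\<lambda>\<epsilon>. remainder_coeff (A \<epsilon>) 2) 0" "isCont (\<lambda>\<epsilon>. remainder_coeff (A \<epsilon>) 3) 0"
    unfolding remainder_coeff_simps by (intro continuous_intros assms(1))+
  have "isCont (\<lambda>\<epsilon>. genericity (A \<epsilon>)) 0"
    unfolding genericity_def Let_def hessian_disc_def
    by (intro continuous_intros assms(1) c)
  then have "eventually (\<lambda>\<epsilon>. genericity (A \<epsilon>) \<noteq> 0) (at 0)"
    unfolding isCont_def using assms(2) by (rule tendsto_imp_eventually_ne)
  then have "eventually (\<lambda>\<epsilon>. \<epsilon> \<noteq> 0 \<and> genericity (A \<epsilon>) \<noteq> 0) (at 0)"
    by (intro eventually_conj eventually_neq_at_within)
  then have "\<exists>\<epsilon>. \<epsilon> \<noteq> 0 \<and> genericity (A \<epsilon>) \<noteq> 0"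
    by (rule eventually_happens'[rotated]) simp
  then show ?thesis
    using that by blast
qed

lemma continuous_coeff_mult:
  fixes p q :: "complex \<Rightarrow> complex poly"
  assumes "\<And>k. isCont (\<lambda>\<epsilon>. coeff (p \<epsilon>) k) a" and "\<And>k. isCont (\<lambda>\<epsilon>. coeff (q \<epsilon>) k) a"
  shows "isCont (\<lambda>\<epsilon>. coeff (p \<epsilon> * q \<epsilon>) k) a"
  unfolding coeff_mult by (intro continuous_intros assms)

lemma continuous_coeff_pcompose_const:
  fixes p :: "complex \<Rightarrow> complex poly"
  assumes "\<And>k. isCont (\<lambda>\<epsilon>. coeff (p \<epsilon>) k) a"
  shows "isCont (\<lambda>\<epsilon>. coeff (pcompose h (p \<epsilon>)) k) a"
proof (induction h arbitrary: k)
  case 0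
  then show ?case by simp
next
  case (pCons c h)
  show ?case
    unfolding pcompose_pCons coeff_add
    by (intro continuous_intros continuous_coeff_mult assms pCons.IH)
qed

text \<open>
  Zooming in on the root: \<open>F \<epsilon>\<close> is \<open>\<epsilon>\<^bsup>-m\<^esup> f(\<epsilon> (1 + s))\<close> for \<open>f = t\<^sup>m h\<close>, written without the
  division so that \<open>\<epsilon> = 0\<close> makes sense. The base point \<open>s = 0\<close> corresponds to \<open>t = \<epsilon>\<close>, a point
  near the root at which the expansion of the cube root is taken.
\<close>

lemma root_at_0_sum_of_3_cubes:
  assumes m: "m \<in> {1, 2, 4, 5}" and deg: "degree ([:0, 1:] ^ m * h) \<le> 6" and h0: "coeff h 0 \<noteq> 0"
  shows "sum_of_3_cubes ([:0, 1:] ^ m * h)"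
proof -
  define F where "F \<epsilon> = [:1, 1:] ^ m * pcompose h [:\<epsilon>, \<epsilon>:]" for \<epsilon>
  have "isCont (\<lambda>\<epsilon>. coeff (F \<epsilon>) k) 0" for k
    unfolding F_def
  proof (intro continuous_coeff_mult continuous_coeff_pcompose_const)
    show "isCont (\<lambda>\<epsilon>. coeff [:\<epsilon>, \<epsilon>:] k) (0::complex)" for k
      by (cases k; cases "k - 1") (auto simp: coeff_pCons)
  qed auto
  moreover have "coeff (F 0) k = coeff h 0 * of_nat (m choose k)" for k
    by (cases "k \<le> m")
       (auto simp: F_def pcompose_0' coeff_linear_poly_power binomial_eq_0 coeff_eq_0 degree_power_eq)
  then have "genericity (coeff (F 0)) \<noteq> 0"
    using genericity_binomial[OF m h0] by presburger
  ultimately obtain \<epsilon> where \<epsilon>: "\<epsilon> \<noteq> 0" "genericity (coeff (F \<epsilon>)) \<noteq> 0"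
    by (rule genericity_eventually_nonzero)
  have "h \<noteq> 0" using h0 by auto
  then have "m + degree h \<le> 6"
    using deg by (simp add: degree_mult_eq degree_power_eq)
  then have "degree (F \<epsilon>) \<le> 6"
    using degree_mult_le[of "[:1, 1:] ^ m" "pcompose h [:\<epsilon>, \<epsilon>:]"] \<epsilon>
    by (simp add: F_def degree_power_eq degree_pcompose)
  then have "sum_of_3_cubes (F \<epsilon>)"
    using \<epsilon>(2) by (rule generic_sum_of_3_cubes)
  then have "sum_of_3_cubes (smult (\<epsilon> ^ m) (pcompose (F \<epsilon>) [:- 1, 1 / \<epsilon>:]))"
    by (intro sum_of_3_cubes_smult sum_of_3_cubes_pcompose) auto
  \<comment> \<open>The substitution \<open>s = t / \<epsilon> - 1\<close> undoes \<open>t = \<epsilon> (1 + s)\<close>.\<close>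
  also have "pcompose (F \<epsilon>) [:- 1, 1 / \<epsilon>:] = [:0, 1 / \<epsilon>:] ^ m * h"
    using \<epsilon>(1)
    by (simp add: F_def pcompose_mult pcompose_power pcompose_pCons flip: pcompose_assoc)
  also have "smult (\<epsilon> ^ m) ([:0, 1 / \<epsilon>:] ^ m * h) = (smult \<epsilon> [:0, 1 / \<epsilon>:]) ^ m * h"
    by (simp only: smult_power mult_smult_left)
  finally show ?thesis using \<epsilon>(1) by simp
qed

lemma root_sum_of_3_cubes:
  assumes f: "f \<noteq> 0" "degree f \<le> 6" and m: "order r f \<in> {1, 2, 4, 5}"
  shows "sum_of_3_cubes f"
proof -
  obtain g where g: "f = [:- r, 1:] ^ order r f * g" "\<not> [:- r, 1:] dvd g"
    using order_decomp[OF f(1)] by blast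
  define h where "h = pcompose g [:r, 1:]"
  have eq: "pcompose f [:r, 1:] = [:0, 1:] ^ order r f * h"
    by (subst g(1)) (simp add: h_def pcompose_mult pcompose_power pcompose_pCons)
  have "coeff h 0 \<noteq> 0"
    using g(2) by (simp add: h_def poly_pcompose poly_eq_0_iff_dvd [symmetric] flip: poly_0_coeff_0)
  then have "sum_of_3_cubes (pcompose f [:r, 1:])"
    unfolding eq using f(2) by (intro root_at_0_sum_of_3_cubes m) (simp_all add: degree_pcompose flip: eq)
  then have "sum_of_3_cubes (pcompose (pcompose f [:r, 1:]) [:- r, 1:])"
    by (rule sum_of_3_cubes_pcompose) simp
  also have "pcompose (pcompose f [:r, 1:]) [:- r, 1:] = pcompose f (pcompose [:r, 1:] [:- r, 1:])"
    by (rule pcompose_assoc [symmetric])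
  also have "pcompose [:r, 1:] [:- r, 1:] = [:0, 1:]"
    by (simp add: pcompose_pCons)
  finally show ?thesis by simp
qed

section \<open>All sextics\<close>

text \<open>
  Look for a root whose multiplicity is neither \<open>3\<close> nor \<open>6\<close>. If there is none, the degree bound
  leaves only constants and the constant multiples of \<open>(t - r)\<^sup>6\<close>, \<open>(t - r)\<^sup>3\<close> and
  \<open>((t - r) (t - s))\<^sup>3\<close>, all of which are cubes. A degree below \<open>6\<close> needs no separate treatment,
  since the preceding section bounds the degree only from above.
\<close>

lemma degree_le_6_sum_of_3_cubes:
  assumes deg: "degree f \<le> 6"
  shows "sum_of_3_cubes f"
proof (cases "degree f = 0")
  case True
  then obtain z where "f = smult z (1 ^ 3)"
    by (auto elim: degree_eq_zeroE)
  then show ?thesis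
    using smult_cube_sum_of_3_cubes[of 1 z] by simp
next
  case False
  then have f0: "f \<noteq> 0" by auto
  have root: "\<exists>r. poly g r = 0" if "degree g \<noteq> 0" for g :: "complex poly"
    using that by (simp add: fundamental_theorem_of_algebra constant_degree)
  then obtain r where "poly f r = 0" using False by blast
  then have "order r f \<noteq> 0" using f0 by (simp add: order_root)
  moreover have "order r f \<le> 6" using order_degree[OF f0, of r] deg by linarith
  ultimately consider "order r f \<in> {1, 2, 4, 5}" | "order r f = 6" | "order r f = 3"
    by fastforce
  then show ?thesis
  proof cases
    case 1
    then show ?thesis using f0 deg by (rule root_sum_of_3_cubes[rotated 2])
  next
    case 2
    then obtain g where g: "f = [:- r, 1:] ^ 6 * g"
      using order_decomp[OF f0, of r] by auto
    then have "degree g = 0"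
      using deg f0 by (auto simp: degree_mult_eq degree_power_eq)
    then obtain z where "f = smult z (([:- r, 1:] ^ 2) ^ 3)"
      using g by (auto elim!: degree_eq_zeroE simp flip: power_mult)
    then show ?thesis
      using smult_cube_sum_of_3_cubes[of "[:- r, 1:] ^ 2" z] by (simp add: degree_power_eq)
  next
    case 3
    then obtain g where g: "f = [:- r, 1:] ^ 3 * g" "\<not> [:- r, 1:] dvd g"
      using order_decomp[OF f0, of r] by auto
    have g0: "g \<noteq> 0" and degg: "degree g \<le> 3"
      using deg f0 g(1) by (auto simp: degree_mult_eq degree_power_eq)
    show ?thesis
    proof (cases "degree g = 0")
      case True
      then obtain z where "f = smult z ([:- r, 1:] ^ 3)"
        using g by (auto elim!: degree_eq_zeroE)
      then show ?thesis
        using smult_cube_sum_of_3_cubes[of "[:- r, 1:]" z] by simp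
    next
      case False
      then obtain s where s: "poly g s = 0" using root by blast
      have "s \<noteq> r" using s g(2) by (auto simp: poly_eq_0_iff_dvd)
      then have "order s ([:- r, 1:] ^ 3) = 0"
        by (intro order_0I) simp
      then have ord: "order s f = order s g"
        using f0 by (simp add: g(1) order_mult)
      have "order s g \<noteq> 0" using s g0 by (simp add: order_root)
      moreover have "order s g \<le> 3" using order_degree[OF g0, of s] degg by linarith
      ultimately consider "order s g \<in> {1, 2, 4, 5}" | "order s g = 3"
        by fastforce
      then show ?thesis
      proof cases
        case 1
        then show ?thesis using f0 deg by (intro root_sum_of_3_cubes[of f s]) (auto simp: ord)
      next
        case 2
        then obtain h where h: "g = [:- s, 1:] ^ 3 * h"
          using order_decomp[OF g0, of s] by auto
        then have "degree h = 0"
          using degg g0 by (auto simp: degree_mult_eq degree_power_eq)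
        then obtain z where z: "h = [:z:]" by (rule degree_eq_zeroE)
        have "f = smult z (([:- r, 1:] * [:- s, 1:]) ^ 3)"
          by (simp only: g(1) h z power_mult_distrib) (simp add: mult.assoc)
        then show ?thesis
          using smult_cube_sum_of_3_cubes[of "[:- r, 1:] * [:- s, 1:]" z] by simp
      qed
    qed
  qed
qed

theorem theorem3p1:
  fixes p :: "complex poly poly"
  assumes "homogeneous 6 p"
  shows "\<exists>r::nat. \<exists>q :: nat \<Rightarrow> complex poly poly.
           r \<le> 3 \<and> (\<forall>k\<in>{1..r}. homogeneous 2 (q k)) \<and> p = (\<Sum>k=1..r. q k ^ 3)"
proof -
  obtain f where f: "degree f \<le> 6" "p = homogenize 6 f"
    using assms by (rule homogeneous_imp_homogenize)
  obtain a b c where deg: "degree a \<le> 2" "degree b \<le> 2" "degree c \<le> 2"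
    and abc: "f = a ^ 3 + b ^ 3 + c ^ 3"
    using degree_le_6_sum_of_3_cubes[OF f(1)] by (auto simp: sum_of_3_cubes_def)
  define q where "q k = homogenize 2 (if k = 1 then a else if k = 2 then b else c)" for k :: nat
  have "p = homogenize 2 a ^ 3 + homogenize 2 b ^ 3 + homogenize 2 c ^ 3"
    unfolding f(2) abc by (simp add: homogenize_add deg homogenize_cube[of _ 2, simplified])
  also have "\<dots> = (\<Sum>k=1..3. q k ^ 3)"
    by (simp add: q_def numeral_eq_Suc)
  finally show ?thesis
    using deg by (intro exI[of _ 3] exI[of _ q]) (auto simp: q_def homogeneous_homogenize)
qed
end
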